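(* The group-action model $\mathscr{P}^{S_5}_\bullet$ associated with the Petersen graph is generated by its rank-2 invariant tensors together with the GHZ tensor: the family generated by $\mathscr{P}^{S_5}_2\cup\{\mathrm{GHZ}\}$ equals $\mathscr{P}^{S_5}_\bullet$. (Equivalently, the group-subgroup subfactor planar algebra for $S_2\times S_3\subset S_5$ is generated by its $2$-boxes.)
   Context: The Petersen graph $\Gamma$ is the Kneser graph $KG_{5,2}$: vertex set $V_\Gamma$ = the $2$-element subsets of $\{1,\dots,5\}$, adjacency = disjointness. Let $W=\mathbb{C}^{V_\Gamma}$ with basis $(e_v)_{v\in V_\Gamma}$; $S_5$ acts by $\pi\cdot e_{\{a,b\}}=e_{\{\pi(a),\pi(b)\}}$ and diagonally on $W^{\otimes n}$. Set $\mathscr{P}_0=\mathbb{C}$, $\mathscr{P}_n=W^{\otimes n}$, and $\mathscr{P}^{S_5}_n$ = the $S_5$-fixed vectors of $\mathscr{P}_n$. $\mathrm{GHZ}=\sum_{v}e_v\otimes e_v\otimes e_v$. Operations: tensor product; contraction $C_{k,k+1}:\mathscr{P}_n\to\mathscr{P}_{n-2}$, $C_{k,k+1}(e_{v_1}\otimes\cdots\otimes e_{v_n})=\delta_{v_k,v_{k+1}}e_{v_1}\otimes\cdots\otimes\widehat{e_{v_k}}\otimes\widehat{e_{v_{k+1}}}\otimes\cdots\otimes e_{v_n}$; rotation $\rho(e_{v_1}\otimes\cdots\otimes e_{v_n})=e_{v_2}\otimes\cdots\otimes e_{v_n}\otimes e_{v_1}$. The family generated by a set $X$ of tensors is the smallest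 family $(\mathscr{Q}_n)_{n\ge0}$ of linear subspaces $\mathscr{Q}_n\subseteq\mathscr{P}_n$ containing $X$, with $1\in\mathscr{Q}_0$, closed under tensor product, all contractions $C_{k,k+1}$, and rotation. *)

theory Defs
  imports Complex_Main "HOL-Combinatorics.Permutations"
begin

text \<open>Vertices of the Petersen graph KG(5,2): the 2-element subsets of {1..5}.
  (Adjacency = disjointness; it plays no role in the statement itself.)\<close>
definition PV :: "nat set set" where
  "PV = {A. A \<subseteq> {1..5} \<and> card A = 2}"

text \<open>A tensor in W^{\<otimes>n} is represented by its coefficient function with respect to
  the basis e_{v1} \<otimes> ... \<otimes> e_{vn}: a function on vertex lists, supported on
  lists of length n with entries in PV.\<close>
type_synonym tensor = "nat set list \<Rightarrow> complex"

definition is_tensor :: "nat \<Rightarrow> tensor \<Rightarrow> bool" where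
  "is_tensor n T \<longleftrightarrow> (\<forall>xs. T xs \<noteq> 0 \<longrightarrow> length xs = n \<and> set xs \<subseteq> PV)"

definition invariant :: "nat \<Rightarrow> tensor \<Rightarrow> bool" where
  "invariant n T \<longleftrightarrow> is_tensor n T \<and>
     (\<forall>\<pi>. \<pi> permutes {1..5::nat} \<longrightarrow> (\<forall>xs. T (map (\<lambda>A. \<pi> ` A) xs) = T xs))"

definition tprod :: "nat \<Rightarrow> tensor \<Rightarrow> tensor \<Rightarrow> tensor" where
  "tprod m S T = (\<lambda>xs. S (take m xs) * T (drop m xs))"

text \<open>Contraction of positions i+1, i+2 (1-based; i.e. C_{i+1,i+2}).\<close>
definition contract :: "nat \<Rightarrow> tensor \<Rightarrow> tensor" where
  "contract i T = (\<lambda>ys. \<Sum>v\<in>PV. T (take i ys @ v # v # drop i ys))"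

text \<open>Rotation: rho(e_{v1}..e_{vn}) = e_{v2}..e_{vn} e_{v1}; so the coefficient of
  rho T at ws is the coefficient of T at (last ws # butlast ws).\<close>
definition rot :: "tensor \<Rightarrow> tensor" where
  "rot T = (\<lambda>ws. T (rotate (length ws - 1) ws))"

definition unit_tensor :: tensor where
  "unit_tensor = (\<lambda>xs. if xs = [] then 1 else 0)"

definition GHZ :: tensor where
  "GHZ = (\<lambda>xs. if length xs = 3 \<and> xs ! 0 \<in> PV \<and> xs ! 1 = xs ! 0 \<and> xs ! 2 = xs ! 0
               then 1 else 0)"

inductive gen :: "(nat \<times> tensor) set \<Rightarrow> nat \<Rightarrow> tensor \<Rightarrow> bool" for X where
  base: "(n, T) \<in> X \<Longrightarrow> gen X n T"
| one: "gen X 0 unit_tensor"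
| zero: "gen X n (\<lambda>_. 0)"
| add: "gen X n S \<Longrightarrow> gen X n T \<Longrightarrow> gen X n (\<lambda>xs. S xs + T xs)"
| smult: "gen X n T \<Longrightarrow> gen X n (\<lambda>xs. c * T xs)"
| tensor: "gen X m S \<Longrightarrow> gen X n T \<Longrightarrow> gen X (m + n) (tprod m S T)"
| contr: "gen X n T \<Longrightarrow> i + 1 < n \<Longrightarrow> gen X (n - 2) (contract i T)"
| rotate: "gen X n T \<Longrightarrow> gen X n (rot T)"

end

(* Once the crossing is generated, legs can be permuted freely, so any product of kernels
   R(x_i, x_j) with R invariant is generated, and so are the sums over some of the variables.
   A frame of four vertices (a path with five labelled points) has trivial stabiliser, and both its
   orbit and the position of any vertex relative to it are given by pairwise relations; summing over
   the frames gives every orbit sum.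

   The crossing splits according to the relation of the two strands. If they are equal it is a GHZ
   tensor; if they are adjacent it is planar because there are no 4-cycles; if they are at distance
   two, their unique common neighbour s confines both strands to the three neighbours of s, and on
   a set of three points the crossing is a combination of the other partitions of four points. *)
theory Submission
  imports Defs
begin

section \<open>Generated tensors are invariant\<close>

abbreviation Gens :: "(nat \<times> tensor) set" where
  "Gens \<equiv> {(2, T) | T. invariant 2 T} \<union> {(3, GHZ)}"

lemma finite_PV: "finite PV"
  unfolding PV_def by (rule finite_subset[of _ "Pow {1..5}"]) auto

lemma permutes_image_PV_iff:
  assumes "\<pi> permutes {1..5::nat}"
  shows "\<pi> ` A \<in> PV \<longleftrightarrow> A \<in> PV"
proof -
  have inj: "inj \<pi>" using assms by (rule permutes_inj)
  have "card (\<pi> ` A) = card A" by (rule card_image) (meson inj inj_on_subset subset_UNIV)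
  moreover have "\<pi> ` A \<subseteq> {1..5} \<longleftrightarrow> A \<subseteq> {1..5}"
    using permutes_image[OF assms] inj_image_subset_iff[OF inj, of A "{1..5}"] by simp
  ultimately show ?thesis unfolding PV_def by simp
qed

lemma bij_betw_image_PV:
  assumes "\<pi> permutes {1..5::nat}"
  shows "bij_betw (\<lambda>A. \<pi> ` A) PV PV"
proof (rule bij_betwI[where g = "\<lambda>A. inv \<pi> ` A"])
  show "(\<lambda>A. \<pi> ` A) \<in> PV \<rightarrow> PV" using permutes_image_PV_iff[OF assms] by auto
  show "(\<lambda>A. inv \<pi> ` A) \<in> PV \<rightarrow> PV"
    by (simp add: permutes_image_PV_iff[OF permutes_inv[OF assms]])
qed (simp_all add: image_image permutes_inverses[OF assms])

lemma is_tensorD: "is_tensor n T \<Longrightarrow> T xs \<noteq> 0 \<Longrightarrow> length xs = n \<and> set xs \<subseteq> PV"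
  unfolding is_tensor_def by blast

lemma invariant_tprod:
  assumes "invariant m S" "invariant n T"
  shows "invariant (m + n) (tprod m S T)"
proof -
  have ST: "is_tensor m S" "is_tensor n T" using assms unfolding invariant_def by blast+
  have "length xs = m + n \<and> set xs \<subseteq> PV" if nz: "S (take m xs) * T (drop m xs) \<noteq> 0" for xs
  proof -
    have "S (take m xs) \<noteq> 0" "T (drop m xs) \<noteq> 0" using nz by auto
    with ST have "length (take m xs) = m \<and> set (take m xs) \<subseteq> PV"
      and "length (drop m xs) = n \<and> set (drop m xs) \<subseteq> PV"
      by (blast dest: is_tensorD)+
    then have "length (take m xs @ drop m xs) = m + n \<and> set (take m xs @ drop m xs) \<subseteq> PV"
      by (simp only: length_append set_append) blast
    then show ?thesis by (simp only: append_take_drop_id)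
  qed
  then have "is_tensor (m + n) (tprod m S T)" unfolding is_tensor_def tprod_def by blast
  moreover have "tprod m S T (map (\<lambda>A. \<pi> ` A) xs) = tprod m S T xs"
    if "\<pi> permutes {1..5}" for \<pi> xs
    using assms that unfolding invariant_def tprod_def take_map drop_map by metis
  ultimately show ?thesis unfolding invariant_def by blast
qed

lemma invariant_contract:
  assumes "invariant n T" "i + 1 < n"
  shows "invariant (n - 2) (contract i T)"
proof -
  have T: "is_tensor n T" using assms(1) unfolding invariant_def by blast
  have "length ys = n - 2 \<and> set ys \<subseteq> PV" if nz: "contract i T ys \<noteq> 0" for ys
  proof -
    obtain v where "T (take i ys @ v # v # drop i ys) \<noteq> 0"
      using nz sum.not_neutral_contains_not_neutral unfolding contract_def by blast
    from is_tensorD[OF T this]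
    have l: "length (take i ys @ v # v # drop i ys) = n"
      and s: "set (take i ys) \<union> set (drop i ys) \<subseteq> PV" by auto
    have "set (take i ys) \<union> set (drop i ys) = set ys"
      by (metis append_take_drop_id set_append)
    then show ?thesis using l s by auto
  qed
  moreover have "contract i T (map (\<lambda>A. \<pi> ` A) ys) = contract i T ys"
    if \<pi>: "\<pi> permutes {1..5}" for \<pi> ys
  proof -
    \<comment> \<open>Since \<open>\<pi>\<close> induces a bijection of \<open>PV\<close>, the
      contracted vertex can be moved by \<open>\<pi>\<close> along with the other entries.\<close>
    have "contract i T (map (\<lambda>A. \<pi> ` A) ys)
        = (\<Sum>v\<in>PV. T (take i (map (\<lambda>A. \<pi> ` A) ys) @ \<pi> ` v # \<pi> ` v # drop i (map (\<lambda>A. \<pi> ` A) ys)))"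
      unfolding contract_def by (rule sum.reindex_bij_betw[OF bij_betw_image_PV[OF \<pi>], symmetric])
    also have "\<dots> = (\<Sum>v\<in>PV. T (map (\<lambda>A. \<pi> ` A) (take i ys @ v # v # drop i ys)))"
      by (simp add: take_map drop_map)
    also have "\<dots> = contract i T ys"
      using assms(1) \<pi> unfolding contract_def invariant_def by (simp del: map_append list.map)
    finally show ?thesis .
  qed
  ultimately show ?thesis unfolding invariant_def is_tensor_def by blast
qed

lemma invariant_GHZ: "invariant 3 GHZ"
proof -
  have "length xs = 3 \<and> set xs \<subseteq> PV" if "GHZ xs \<noteq> 0" for xs
    using that unfolding GHZ_def
    by (auto split: if_splits simp: numeral_3_eq_3 length_Suc_conv)
  moreover have "GHZ (map (\<lambda>A. \<pi> ` A) xs) = GHZ xs" if "\<pi> permutes {1..5}" for \<pi> xs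
    using permutes_image_PV_iff[OF that] inj_image_eq_iff[OF permutes_inj[OF that]]
    unfolding GHZ_def by auto
  ultimately show ?thesis unfolding invariant_def is_tensor_def by blast
qed

text \<open>The generating operations all commute with the diagonal action and respect supports, so
  invariance passes through the induction.\<close>

lemma gen_imp_invariant: "gen Gens n T \<Longrightarrow> invariant n T"
proof (induction rule: gen.induct)
  case (base n T)
  then show ?case using invariant_GHZ by auto
next
  case (rotate n T)
  then have T: "is_tensor n T" and inv: "\<pi> permutes {1..5} \<Longrightarrow> T (map (\<lambda>A. \<pi> ` A) xs) = T xs" for \<pi> xs
    unfolding invariant_def by blast+
  have "is_tensor n (rot T)"
    using T unfolding is_tensor_def rot_def by (metis length_rotate set_rotate)
  moreover have "rot T (map (\<lambda>A. \<pi> ` A) xs) = rot T xs" if "\<pi> permutes {1..5}" for \<pi> xs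
    unfolding rot_def length_map rotate_map by (rule inv[OF that])
  ultimately show ?case unfolding invariant_def by blast
next
  case (add n S T)
  have "length xs = n \<and> set xs \<subseteq> PV" if "S xs + T xs \<noteq> 0" for xs
  proof -
    have "S xs \<noteq> 0 \<or> T xs \<noteq> 0" using that by auto
    then show ?thesis using add is_tensorD unfolding invariant_def by blast
  qed
  then have "is_tensor n (\<lambda>xs. S xs + T xs)" unfolding is_tensor_def by blast
  then show ?case using add unfolding invariant_def by metis
next
  case (tensor m S n T)
  then show ?case by (blast intro: invariant_tprod)
next
  case (contr n T i)
  then show ?case by (blast intro: invariant_contract)
qed (auto simp: invariant_def is_tensor_def unit_tensor_def split: if_splits)

section \<open>Planar operations\<close>

text \<open>The coefficients of a tensor off \<open>PV\<^sup>n\<close> are zero; \<open>cut\<close> lets us describe a tensor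
  by any function that is correct on \<open>PV\<^sup>n\<close>.\<close>

definition cut :: "nat \<Rightarrow> tensor \<Rightarrow> tensor" where
  "cut n f = (\<lambda>xs. if length xs = n \<and> set xs \<subseteq> PV then f xs else 0)"

definition Q :: "nat \<Rightarrow> tensor \<Rightarrow> bool" where
  "Q n f \<longleftrightarrow> gen Gens n (cut n f)"

lemma Q_cong:
  assumes "Q n f" "\<And>xs. length xs = n \<Longrightarrow> set xs \<subseteq> PV \<Longrightarrow> f xs = g xs"
  shows "Q n g"
proof -
  have "cut n f = cut n g" unfolding cut_def using assms(2) by auto
  then show ?thesis using assms(1) unfolding Q_def by simp
qed

lemma Q_add:
  assumes "Q n f" "Q n g"
  shows "Q n (\<lambda>xs. f xs + g xs)"
proof -
  have "cut n (\<lambda>xs. f xs + g xs) = (\<lambda>xs. cut n f xs + cut n g xs)" unfolding cut_def by auto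
  then show ?thesis using gen.add[OF assms[unfolded Q_def]] unfolding Q_def by simp
qed

lemma Q_smult:
  assumes "Q n f"
  shows "Q n (\<lambda>xs. c * f xs)"
proof -
  have "cut n (\<lambda>xs. c * f xs) = (\<lambda>xs. c * cut n f xs)" unfolding cut_def by auto
  then show ?thesis using gen.smult[OF assms[unfolded Q_def]] unfolding Q_def by simp
qed

lemma Q_zero: "Q n (\<lambda>_. 0)"
proof -
  have "cut n (\<lambda>_. 0) = (\<lambda>_. 0)" unfolding cut_def by auto
  then show ?thesis using gen.zero[of Gens n] unfolding Q_def by simp
qed

lemma Q_sum:
  assumes "finite I" "\<And>i. i \<in> I \<Longrightarrow> Q n (f i)"
  shows "Q n (\<lambda>xs. \<Sum>i\<in>I. f i xs)"
  using assms
proof (induction I rule: finite_induct)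
  case empty
  show ?case by (simp add: Q_zero)
next
  case (insert i I)
  then have "Q n (\<lambda>xs. f i xs + (\<Sum>i\<in>I. f i xs))" by (intro Q_add) auto
  then show ?case using insert.hyps by simp
qed

lemma Q_tprod:
  assumes "Q m f" "Q n g"
  shows "Q (m + n) (\<lambda>xs. f (take m xs) * g (drop m xs))"
proof -
  have eq: "tprod m (cut m f) (cut n g) = cut (m + n) (\<lambda>xs. f (take m xs) * g (drop m xs))"
  proof
    fix xs :: "nat set list"
    have "set xs = set (take m xs) \<union> set (drop m xs)"
      by (metis append_take_drop_id set_append)
    then show "tprod m (cut m f) (cut n g) xs
        = cut (m + n) (\<lambda>xs. f (take m xs) * g (drop m xs)) xs"
      unfolding tprod_def cut_def by auto
  qed
  show ?thesis using gen.tensor[OF assms[unfolded Q_def]] unfolding Q_def eq .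
qed

text \<open>The rank is written \<open>n + 2\<close> so that the truncated subtraction in
  \<open>gen.contr\<close> disappears.\<close>

lemma Q_contract:
  assumes "Q (n + 2) f" "k \<le> n"
  shows "Q n (\<lambda>ys. \<Sum>v\<in>PV. f (take k ys @ v # v # drop k ys))"
proof -
  have eq: "contract k (cut (n + 2) f) = cut n (\<lambda>ys. \<Sum>v\<in>PV. f (take k ys @ v # v # drop k ys))"
  proof
    fix ys :: "nat set list"
    have s: "set (take k ys) \<union> set (drop k ys) = set ys"
      by (metis append_take_drop_id set_append)
    have "cut (n + 2) f (take k ys @ v # v # drop k ys)
        = (if length ys = n \<and> set ys \<subseteq> PV then f (take k ys @ v # v # drop k ys) else 0)"
      if "v \<in> PV" for v
      using that s unfolding cut_def by auto
    then show "contract k (cut (n + 2) f) ys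
        = cut n (\<lambda>ys. \<Sum>v\<in>PV. f (take k ys @ v # v # drop k ys)) ys"
      unfolding contract_def cut_def[of n] by (cases "length ys = n \<and> set ys \<subseteq> PV") (auto cong: sum.cong)
  qed
  have "gen Gens (n + 2 - 2) (contract k (cut (n + 2) f))"
    using assms by (intro gen.contr) (auto simp: Q_def)
  then show ?thesis unfolding Q_def eq by simp
qed

text \<open>The generator \<open>rot\<close> turns in one direction only; the opposite turn is one
  of its powers, because \<open>(n - 1) * (n - 1)\<close> is congruent to 1 modulo
  \<open>n\<close>.\<close>

lemma Q_rotate:
  assumes "Q n f"
  shows "Q n (\<lambda>xs. f (rotate j xs))"
proof -
  have unrotate: "Q n (\<lambda>xs. g (rotate (n - 1) xs))" if "Q n g" for g
  proof -
    have "rot (cut n g) = cut n (\<lambda>xs. g (rotate (n - 1) xs))"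
      unfolding rot_def cut_def by auto
    then show ?thesis using gen.rotate[OF that[unfolded Q_def]] unfolding Q_def by simp
  qed
  have iter: "Q n (\<lambda>xs. g (rotate (p * (n - 1)) xs))" if "Q n g" for g p
  proof (induction p)
    case 0
    then show ?case using that by simp
  next
    case (Suc p)
    from unrotate[OF this] show ?case by (simp add: rotate_rotate add.commute)
  qed
  have one: "Q n (\<lambda>xs. g (rotate1 xs))" if "Q n g" for g
  proof (rule Q_cong[OF iter[OF that, of "n - 1"]])
    fix xs :: "nat set list" assume l: "length xs = n"
    show "g (rotate ((n - 1) * (n - 1)) xs) = g (rotate1 xs)"
    proof (cases n)
      case 0
      then show ?thesis using l by simp
    next
      case (Suc k)
      \<comment> \<open>Here \<open>k = n - 1\<close>. The right side stays
        \<open>1 mod Suc k\<close> because it is 0 for \<open>n = 1\<close>.\<close>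
      have "(k * k) mod Suc k = 1 mod Suc k"
      proof (cases k)
        case (Suc i)
        have "k * k = i * Suc k + 1" using Suc by simp
        then show ?thesis by (metis mod_mult_self3)
      qed simp
      then have "rotate (k * k) xs = rotate 1 xs"
        using l Suc by (metis rotate_conv_mod)
      then show ?thesis using Suc by simp
    qed
  qed
  show ?thesis
  proof (induction j)
    case 0
    then show ?case using assms by simp
  next
    case (Suc j)
    from one[OF this] show ?case by (simp add: rotate1_rotate_swap)
  qed
qed

text \<open>The tensor \<open>f\<close> is rotated until the gap after its first \<open>k\<close>
  legs lies at the end, \<open>g\<close> is appended there, and the product is rotated back.\<close>

lemma Q_insert:
  assumes "Q n f" "Q m g" "k \<le> n"
  shows "Q (n + m) (\<lambda>xs. f (take k xs @ drop (k + m) xs) * g (take m (drop k xs)))"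
proof (rule Q_cong[OF Q_rotate[OF Q_tprod[OF Q_rotate[OF assms(1), of "n - k"] assms(2)], of "k + m"]])
  fix xs :: "nat set list" assume l: "length xs = n + m"
  define A G B where "A = take k xs" and "G = take m (drop k xs)" and "B = drop (k + m) xs"
  have xs: "xs = (A @ G) @ B"
    unfolding A_def B_def G_def by (metis append_take_drop_id take_add)
  have lens: "length A = k" "length G = m" "length B = n - k"
    using l assms(3) unfolding A_def B_def G_def by auto
  have r: "rotate (k + m) xs = B @ A @ G"
    using rotate_append[of "A @ G" B] lens by (simp add: xs)
  have "rotate (n - k) (B @ A) = A @ B"
    using rotate_append[of B A] lens by simp
  then show "f (rotate (n - k) (take n (rotate (k + m) xs))) * g (drop n (rotate (k + m) xs))
      = f (take k xs @ drop (k + m) xs) * g (take m (drop k xs))"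
    unfolding r A_def[symmetric] B_def[symmetric] G_def[symmetric] using lens assms(3) by simp
qed

text \<open>Inserting \<open>g\<close> right after leg \<open>k\<close> of \<open>f\<close> (counted
  from 0) makes that leg a neighbour of the first leg of \<open>g\<close>; contracting the two joins
  the boxes along \<open>x\<close>.\<close>

lemma Q_graft:
  assumes "Q (Suc n) f" "Q (Suc m) g" "k \<le> n"
  shows "Q (n + m) (\<lambda>zs. \<Sum>x\<in>PV. f (take k zs @ x # drop (k + m) zs) * g (x # take m (drop k zs)))"
proof -
  have "Q (n + m + 2) (\<lambda>xs. f (take (Suc k) xs @ drop (Suc k + Suc m) xs)
      * g (take (Suc m) (drop (Suc k) xs)))"
    using Q_insert[OF assms(1,2), of "Suc k"] assms(3) by simp
  note c = Q_contract[OF this, of k]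
  show ?thesis
    by (rule Q_cong[OF c]) (use assms(3) in \<open>auto simp: Suc_diff_le min_def\<close>)
qed

text \<open>Two nested lines join the boxes, the inner one contracted first. Nesting reverses the
  order of the legs, hence \<open>x # y\<close> in \<open>f\<close> and \<open>y # x\<close> in
  \<open>g\<close>.\<close>

lemma Q_graft2:
  assumes "Q (n + 2) f" "Q (m + 2) g" "k \<le> n"
  shows "Q (n + m) (\<lambda>zs. \<Sum>x\<in>PV. \<Sum>y\<in>PV.
    f (take k zs @ x # y # drop (k + m) zs) * g (y # x # take m (drop k zs)))"
proof -
  have "Q (n + m + 2 + 2) (\<lambda>xs. f (take (k + 2) xs @ drop (k + 2 + (m + 2)) xs)
      * g (take (m + 2) (drop (k + 2) xs)))"
    using Q_insert[OF assms(1,2), of "k + 2"] assms(3) by (simp add: add_ac)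
  note c = Q_contract[OF Q_contract[OF this, of "Suc k"], of k]
  show ?thesis
    by (rule Q_cong[OF c]) (use assms(3) in \<open>auto simp: Suc_diff_le min_def\<close>)
qed

lemma sum_PV_single:
  fixes h :: "nat set \<Rightarrow> complex"
  assumes "a \<in> PV" "\<And>x. x \<in> PV \<Longrightarrow> x \<noteq> a \<Longrightarrow> h x = 0"
  shows "(\<Sum>x\<in>PV. h x) = h a"
  using assms finite_PV by (subst sum.remove[of PV a]) (auto intro: sum.neutral)

lemma Q_idx: "Q m f \<Longrightarrow> m = n \<Longrightarrow> Q n f"
  by simp

section \<open>Invariant kernels and constant tensors\<close>

definition invariant_kernel :: "(nat set \<Rightarrow> nat set \<Rightarrow> complex) \<Rightarrow> bool" where
  "invariant_kernel R \<longleftrightarrow> (\<forall>\<pi> A B. \<pi> permutes {1..5::nat} \<longrightarrow> R (\<pi> ` A) (\<pi> ` B) = R A B)"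

lemma Q_rel:
  assumes "invariant_kernel R"
  shows "Q 2 (\<lambda>xs. R (xs ! 0) (xs ! 1))"
proof -
  let ?T = "cut 2 (\<lambda>xs. R (xs ! 0) (xs ! 1))"
  have "is_tensor 2 ?T" unfolding is_tensor_def cut_def by auto
  moreover have "?T (map (\<lambda>A. \<pi> ` A) xs) = ?T xs" if \<pi>: "\<pi> permutes {1..5}" for \<pi> xs
  proof -
    have s: "set (map (\<lambda>A. \<pi> ` A) xs) \<subseteq> PV \<longleftrightarrow> set xs \<subseteq> PV"
      using permutes_image_PV_iff[OF \<pi>] by auto
    have "R (map (\<lambda>A. \<pi> ` A) xs ! 0) (map (\<lambda>A. \<pi> ` A) xs ! 1) = R (xs ! 0) (xs ! 1)"
      if "length xs = 2"
      using assms \<pi> that unfolding invariant_kernel_def by simp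
    then show ?thesis unfolding cut_def s by simp
  qed
  ultimately have "invariant 2 ?T" unfolding invariant_def by blast
  then show ?thesis unfolding Q_def by (intro gen.base) blast
qed

lemma Q_GHZ: "Q 3 (\<lambda>xs. of_bool (xs ! 0 = xs ! 1 \<and> xs ! 1 = xs ! 2))"
proof -
  have "cut 3 (\<lambda>xs. of_bool (xs ! 0 = xs ! 1 \<and> xs ! 1 = xs ! 2)) = GHZ"
  proof
    fix xs :: "nat set list"
    show "cut 3 (\<lambda>xs. of_bool (xs ! 0 = xs ! 1 \<and> xs ! 1 = xs ! 2)) xs = GHZ xs"
      unfolding cut_def GHZ_def
      by (cases "length xs = 3") (auto simp: numeral_3_eq_3 length_Suc_conv)
  qed
  moreover have "gen Gens 3 GHZ" by (rule gen.base) simp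
  ultimately show ?thesis unfolding Q_def by simp
qed

text \<open>Contracting two legs of \<open>GHZ\<close> leaves the all-ones vector of rank 1, whose
  tensor powers give the other ranks.\<close>

lemma Q_one: "Q n (\<lambda>_. 1)"
proof (induction n)
  case 0
  have "cut 0 (\<lambda>_. 1) = unit_tensor" unfolding cut_def unit_tensor_def by auto
  then show ?case using gen.one unfolding Q_def by simp
next
  case (Suc n)
  have "Q (1 + 2) (\<lambda>xs. of_bool (xs ! 0 = xs ! 1 \<and> xs ! 1 = xs ! 2))"
    by (rule Q_idx[OF Q_GHZ]) simp
  from Q_contract[OF this, of 0] have "Q 1 (\<lambda>_. 1)"
  proof (rule Q_cong)
    fix ys :: "nat set list" assume "length ys = 1" "set ys \<subseteq> PV"
    then obtain y where y: "ys = [y]" "y \<in> PV" by (cases ys) auto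
    have "(\<Sum>v\<in>PV. of_bool (v = y)) = (of_bool (y = y) :: complex)"
      by (rule sum_PV_single) (use y in auto)
    then show "(\<Sum>v\<in>PV. of_bool ((take 0 ys @ v # v # drop 0 ys) ! 0 = (take 0 ys @ v # v # drop 0 ys) ! 1
        \<and> (take 0 ys @ v # v # drop 0 ys) ! 1 = (take 0 ys @ v # v # drop 0 ys) ! 2)) = (1::complex)"
      using y by simp
  qed simp
  from Q_tprod[OF this Suc.IH] show ?case by simp
qed

section \<open>Boxes with four legs\<close>

abbreviation Q4 :: "(nat set \<Rightarrow> nat set \<Rightarrow> nat set \<Rightarrow> nat set \<Rightarrow> complex) \<Rightarrow> bool" where
  "Q4 h \<equiv> Q 4 (\<lambda>xs. h (xs ! 0) (xs ! 1) (xs ! 2) (xs ! 3))"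

lemma Q4I:
  assumes "Q 4 f"
    and "\<And>a b c d. \<lbrakk>a \<in> PV; b \<in> PV; c \<in> PV; d \<in> PV\<rbrakk> \<Longrightarrow> f [a, b, c, d] = h a b c d"
  shows "Q4 h"
  by (rule Q_cong[OF assms(1)]) (auto simp: numeral_eq_Suc length_Suc_conv assms(2))

lemma Q4_rotate:
  assumes "Q4 h"
  shows "Q4 (\<lambda>a b c d. h b c d a)"
  by (rule Q4I[OF Q_rotate[OF assms, of 1]]) simp

lemma drop_two:
  assumes "Suc k < length zs"
  shows "drop k zs = zs ! k # zs ! Suc k # drop (k + 2) zs"
  using assms by (simp add: Cons_nth_drop_Suc)

text \<open>A four-leg box consumes legs \<open>k\<close> and \<open>k + 1\<close> of
  \<open>f\<close> and puts its other two legs in their place. Strands running straight through it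
  join its first leg to the fourth and its second to the third.\<close>

lemma Q_graft4:
  assumes "Q n f" "Q4 h" "Suc k < n"
  shows "Q n (\<lambda>zs. \<Sum>x\<in>PV. \<Sum>y\<in>PV.
    f (take k zs @ x # y # drop (k + 2) zs) * h y x (zs ! k) (zs ! Suc k))"
proof -
  have "n - 2 + 2 = n" using assms(3) by simp
  then have "Q (n - 2 + 2) f" "Q (2 + 2) (\<lambda>xs. h (xs ! 0) (xs ! 1) (xs ! 2) (xs ! 3))"
    using assms by simp_all
  note g = Q_graft2[OF this, of k]
  have "Q n (\<lambda>zs. \<Sum>x\<in>PV. \<Sum>y\<in>PV. f (take k zs @ x # y # drop (k + 2) zs)
      * h ((y # x # take 2 (drop k zs)) ! 0) ((y # x # take 2 (drop k zs)) ! 1)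
          ((y # x # take 2 (drop k zs)) ! 2) ((y # x # take 2 (drop k zs)) ! 3))"
    using g assms(3) \<open>n - 2 + 2 = n\<close> by simp
  then show ?thesis
  proof (rule Q_cong)
    fix zs :: "nat set list" assume "length zs = n"
    then have "take 2 (drop k zs) = [zs ! k, zs ! Suc k]"
      using assms(3) by (simp add: drop_two)
    then show "(\<Sum>x\<in>PV. \<Sum>y\<in>PV. f (take k zs @ x # y # drop (k + 2) zs)
      * h ((y # x # take 2 (drop k zs)) ! 0) ((y # x # take 2 (drop k zs)) ! 1)
          ((y # x # take 2 (drop k zs)) ! 2) ((y # x # take 2 (drop k zs)) ! 3))
      = (\<Sum>x\<in>PV. \<Sum>y\<in>PV.
          f (take k zs @ x # y # drop (k + 2) zs) * h y x (zs ! k) (zs ! Suc k))"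
      by simp
  qed
qed



text \<open>A \<open>GHZ\<close> tensor splits each of two neighbouring strands and \<open>R\<close>
  joins the two inner branches, so coefficients are multiplied pointwise.\<close>

lemma Q_mult_adjacent:
  assumes "Q n f" "invariant_kernel R" "Suc k < n"
  shows "Q n (\<lambda>zs. f zs * R (zs ! k) (zs ! Suc k))"
proof -
  have R: "Q (Suc 1) (\<lambda>xs. R (xs ! 0) (xs ! 1))"    by (rule Q_idx[OF Q_rel[OF assms(2)]]) simp
  have G: "Q (Suc 2) (\<lambda>xs. of_bool (xs ! 0 = xs ! 1 \<and> xs ! 1 = xs ! 2))"
    by (rule Q_idx[OF Q_GHZ]) simp
  have 1: "Q (Suc 2) (\<lambda>zs. R (zs ! 0) (zs ! 1) * of_bool (zs ! 1 = zs ! 2))"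
  proof -
    have "Q (1 + 2) (\<lambda>zs. R (zs ! 0) (zs ! 1) * of_bool (zs ! 1 = zs ! 2))"
    proof (rule Q_cong[OF Q_graft[OF R G, of 1]])
      fix zs :: "nat set list" assume "length zs = 1 + 2" "set zs \<subseteq> PV"
      then obtain a b c where z: "zs = [a, b, c]" "a \<in> PV" "b \<in> PV" "c \<in> PV"
        by (auto simp: numeral_eq_Suc length_Suc_conv)
      have "(\<Sum>x\<in>PV. R a x * of_bool (x = b \<and> b = c)) = R a b * of_bool (b = b \<and> b = c)"
        by (rule sum_PV_single) (use z in auto)
      then show "(\<Sum>x\<in>PV. R ((take 1 zs @ x # drop (1 + 2) zs) ! 0) ((take 1 zs @ x # drop (1 + 2) zs) ! 1) *
          of_bool ((x # take 2 (drop 1 zs)) ! 0 = (x # take 2 (drop 1 zs)) ! 1 \<and>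
            (x # take 2 (drop 1 zs)) ! 1 = (x # take 2 (drop 1 zs)) ! 2)) =
        R (zs ! 0) (zs ! 1) * of_bool (zs ! 1 = zs ! 2)"
        using z by simp
    qed simp
    then show ?thesis by (rule Q_idx) simp
  qed
  have "Q 4 (\<lambda>zs. \<Sum>x\<in>PV. R x (zs ! 2) * of_bool (zs ! 2 = zs ! 3) * of_bool (x = zs ! 0 \<and> zs ! 0 = zs ! 1))"
  proof -
    have "Q (2 + 2) (\<lambda>zs. \<Sum>x\<in>PV. R x (zs ! 2) * of_bool (zs ! 2 = zs ! 3) * of_bool (x = zs ! 0 \<and> zs ! 0 = zs ! 1))"
      by (rule Q_cong[OF Q_graft[OF 1 G, of 0]]) (auto simp: numeral_eq_Suc length_Suc_conv)
    then show ?thesis by simp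
  qed
  then have "Q4 (\<lambda>p q r s. of_bool (p = q \<and> r = s) * R q r)"
  proof (rule Q4I)
    fix a b c d assume "a \<in> PV" "b \<in> PV"
    then have "(\<Sum>x\<in>PV. R x c * of_bool (c = d) * of_bool (x = a \<and> a = b)) = R a c * of_bool (c = d) * of_bool (a = a \<and> a = b)"
      by (intro sum_PV_single) auto
    then show "(\<Sum>x\<in>PV. R x ([a, b, c, d] ! 2) * of_bool ([a, b, c, d] ! 2 = [a, b, c, d] ! 3) *
        of_bool (x = [a, b, c, d] ! 0 \<and> [a, b, c, d] ! 0 = [a, b, c, d] ! 1)) =
      of_bool (a = b \<and> c = d) * R b c"
      by (cases "a = b"; cases "c = d") simp_all
  qed
  \<comment> \<open>The quarter turn makes the two pairs of equal legs the strands that run straight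
    through the box.\<close>
  from Q_graft4[OF assms(1) Q4_rotate[OF this] assms(3)] show ?thesis
  proof (rule Q_cong)
    fix zs :: "nat set list" assume z: "length zs = n" "set zs \<subseteq> PV"
    have m: "zs ! k \<in> PV" "zs ! Suc k \<in> PV" using z assms(3) by (auto simp: subset_iff)
    have "(\<Sum>x\<in>PV. \<Sum>y\<in>PV. f (take k zs @ x # y # drop (k + 2) zs) *
          (of_bool (x = zs ! k \<and> zs ! Suc k = y) * R (zs ! k) (zs ! Suc k)))
      = (\<Sum>y\<in>PV. f (take k zs @ zs ! k # y # drop (k + 2) zs) *
          (of_bool (zs ! k = zs ! k \<and> zs ! Suc k = y) * R (zs ! k) (zs ! Suc k)))"
      by (rule sum_PV_single) (use m in \<open>auto intro: sum.neutral\<close>)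
    also have "\<dots> = f (take k zs @ zs ! k # zs ! Suc k # drop (k + 2) zs) *
          (of_bool (zs ! k = zs ! k \<and> zs ! Suc k = zs ! Suc k) * R (zs ! k) (zs ! Suc k))"
      by (rule sum_PV_single) (use m in auto)
    finally show "(\<Sum>x\<in>PV. \<Sum>y\<in>PV. f (take k zs @ x # y # drop (k + 2) zs) *
          (of_bool (x = zs ! k \<and> zs ! Suc k = y) * R (zs ! k) (zs ! Suc k)))
        = f zs * R (zs ! k) (zs ! Suc k)"
      using drop_two[of k zs] append_take_drop_id[of k zs] assms(3) z(1) by simp
  qed
qed

lemma Q4_mult01: "Q4 h \<Longrightarrow> invariant_kernel R \<Longrightarrow> Q4 (\<lambda>a b c d. h a b c d * R a b)"
  using Q_mult_adjacent[where n = 4 and k = 0] by simp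

lemma Q4_mult12: "Q4 h \<Longrightarrow> invariant_kernel R \<Longrightarrow> Q4 (\<lambda>a b c d. h a b c d * R b c)"
  using Q_mult_adjacent[where n = 4 and k = 1] by (simp add: numeral_2_eq_2)

lemma Q4_mult23: "Q4 h \<Longrightarrow> invariant_kernel R \<Longrightarrow> Q4 (\<lambda>a b c d. h a b c d * R c d)"
  using Q_mult_adjacent[where n = 4 and k = 2] by (simp add: numeral_eq_Suc)

text \<open>Legs \<open>d\<close> and \<open>a\<close> are neighbours on the circle but not in the
  list: three quarter turns bring them to the end of the list, and a fourth restores the
  order.\<close>

lemma Q4_mult30:
  assumes "Q4 h" "invariant_kernel R"
  shows "Q4 (\<lambda>a b c d. h a b c d * R d a)"
  using Q4_rotate[OF Q4_mult23[OF Q4_rotate[OF Q4_rotate[OF Q4_rotate[OF assms(1)]]] assms(2)]] .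

text \<open>Grafting a rank-2 tensor onto a leg applies it as a linear operator to that leg.\<close>

lemma Q4_act0:
  assumes "Q4 h" "invariant_kernel R"
  shows "Q4 (\<lambda>a b c d. \<Sum>x\<in>PV. h x b c d * R x a)"
proof -
  have "Q (Suc 3) (\<lambda>xs. h (xs ! 0) (xs ! 1) (xs ! 2) (xs ! 3))"
    "Q (Suc 1) (\<lambda>xs. R (xs ! 0) (xs ! 1))"
    by (rule Q_idx[OF assms(1)], simp) (rule Q_idx[OF Q_rel[OF assms(2)]], simp)
  note g = Q_graft[OF this, of 0]
  have "Q 4 (\<lambda>zs. \<Sum>x\<in>PV. h ((take 0 zs @ x # drop (0 + 1) zs) ! 0)
      ((take 0 zs @ x # drop (0 + 1) zs) ! 1) ((take 0 zs @ x # drop (0 + 1) zs) ! 2)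
      ((take 0 zs @ x # drop (0 + 1) zs) ! 3)
      * R ((x # take 1 (drop 0 zs)) ! 0) ((x # take 1 (drop 0 zs)) ! 1))"
    by (rule Q_idx[OF g]) simp_all
  then show ?thesis by (rule Q4I) (simp add: numeral_eq_Suc)
qed

lemma Q4_act1:
  assumes "Q4 h" "invariant_kernel R"
  shows "Q4 (\<lambda>a b c d. \<Sum>x\<in>PV. h a x c d * R x b)"
  using Q4_rotate[OF Q4_act0[OF Q4_rotate[OF Q4_rotate[OF Q4_rotate[OF assms(1)]]] assms(2)]] .

lemma Q4_act2:
  assumes "Q4 h" "invariant_kernel R"
  shows "Q4 (\<lambda>a b c d. \<Sum>x\<in>PV. h a b x d * R x c)"
  using Q4_rotate[OF Q4_act1[OF Q4_rotate[OF Q4_rotate[OF Q4_rotate[OF assms(1)]]] assms(2)]] .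

lemma Q4_act3:
  assumes "Q4 h" "invariant_kernel R"
  shows "Q4 (\<lambda>a b c d. \<Sum>x\<in>PV. h a b c x * R x d)"
  using Q4_rotate[OF Q4_act2[OF Q4_rotate[OF Q4_rotate[OF Q4_rotate[OF assms(1)]]] assms(2)]] .

section \<open>The crossing is generated\<close>

text \<open>The crossing is the kernel \<open>same a c * same b d\<close>, with the four legs \<open>a, b, c, d\<close> in cyclic order.
  Kernels built with factors on cyclically neighbouring legs only are planar.\<close>

definition adj :: "nat set \<Rightarrow> nat set \<Rightarrow> complex" where
  "adj v w = of_bool (v \<inter> w = {})"

definition same :: "nat set \<Rightarrow> nat set \<Rightarrow> complex" where
  "same v w = of_bool (v = w)"

lemma invariant_kernel_adj: "invariant_kernel adj"
  unfolding invariant_kernel_def adj_def by (auto simp: image_Int[OF permutes_inj, symmetric])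

lemma invariant_kernel_same: "invariant_kernel same"
  unfolding invariant_kernel_def same_def by (auto simp: inj_image_eq_iff[OF permutes_inj])

section \<open>Counting common neighbours in the Petersen graph\<close>

lemma PV_D: "v \<in> PV \<Longrightarrow> v \<subseteq> {1..5} \<and> card v = 2 \<and> finite v"
  unfolding PV_def using finite_subset by auto

text \<open>Common neighbours are the 2-subsets of the complement of \<open>a \<union> c\<close>,
  which has 5 - (4 - |\<open>a \<inter> c\<close>|) points. The case \<open>a = c\<close> gives the
  degree 3.\<close>

lemma card_common_neighbours:
  assumes "a \<in> PV" "c \<in> PV"
  shows "card {s \<in> PV. a \<inter> s = {} \<and> c \<inter> s = {}} = Suc (card (a \<inter> c)) choose 2"
proof -
  note D = PV_D[OF assms(1)] PV_D[OF assms(2)]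
  have "{s \<in> PV. a \<inter> s = {} \<and> c \<inter> s = {}} = {s. s \<subseteq> {1..5} - (a \<union> c) \<and> card s = 2}"
    unfolding PV_def by auto
  then have eq: "card {s \<in> PV. a \<inter> s = {} \<and> c \<inter> s = {}} = card ({1..5} - (a \<union> c)) choose 2"
    by (simp add: n_subsets)
  have "card ({1..5} - (a \<union> c)) = 5 - card (a \<union> c)"
    using D by (subst card_Diff_subset) auto
  moreover have "card (a \<union> c) + card (a \<inter> c) = 4"
    using D card_Un_Int[of a c] by simp
  ultimately have "card ({1..5} - (a \<union> c)) = Suc (card (a \<inter> c))" by linarith
  with eq show ?thesis by simp
qed

lemma card_Int_PV:
  assumes "a \<in> PV" "c \<in> PV"
  shows "card (a \<inter> c) = (if a = c then 2 else if a \<inter> c = {} then 0 else 1)"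
proof -
  note D = PV_D[OF assms(1)] PV_D[OF assms(2)]
  consider "a = c" | "a \<noteq> c" "a \<inter> c = {}" | "a \<noteq> c" "a \<inter> c \<noteq> {}" by blast
  then show ?thesis
  proof cases
    case 3
    have "a \<inter> c \<subset> a"
      using 3 D card_subset_eq[of c a] by (metis Int_lower1 inf.absorb_iff1 psubsetI)
    then have "card (a \<inter> c) < 2" using D psubset_card_mono by metis
    moreover have "card (a \<inter> c) \<noteq> 0" using 3 D by (simp add: card_eq_0_iff)
    ultimately show ?thesis using 3 by simp
  qed (use D in auto)
qed

text \<open>These are the entries of the squared adjacency matrix: the graph is strongly regular
  with parameters (10, 3, 0, 1).\<close>

lemma sum_adj_adj:
  assumes "a \<in> PV" "c \<in> PV"
  shows "(\<Sum>s\<in>PV. adj s a * adj s c) = (if a = c then 3 else if a \<inter> c = {} then 0 else 1)"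
proof -
  have "(\<Sum>s\<in>PV. adj s a * adj s c) = (\<Sum>s\<in>PV. of_bool (a \<inter> s = {} \<and> c \<inter> s = {}))"
    unfolding adj_def by (intro sum.cong) (auto simp: Int_commute)
  also have "\<dots> = of_nat (card {s \<in> PV. a \<inter> s = {} \<and> c \<inter> s = {}})"
    using sum.inter_filter[OF finite_PV, of "\<lambda>_. 1 :: complex" "\<lambda>s. a \<inter> s = {} \<and> c \<inter> s = {}"]
    by (simp add: of_bool_def)
  finally show ?thesis
    unfolding card_common_neighbours[OF assms] card_Int_PV[OF assms]
    by (auto simp: choose_two)
qed

text \<open>Distinct vertices have at most one common neighbour, whereas \<open>b\<close> and
  \<open>d\<close> are both common neighbours of \<open>a\<close> and \<open>c\<close>.\<close>

lemma no_four_cycle: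
  assumes "a \<in> PV" "b \<in> PV" "c \<in> PV" "d \<in> PV"
    and "a \<inter> b = {}" "c \<inter> b = {}" "a \<inter> d = {}" "c \<inter> d = {}"
  shows "a = c \<or> b = d"
proof (rule ccontr)
  assume ne: "\<not> (a = c \<or> b = d)"
  then have "{b, d} \<subseteq> {s \<in> PV. a \<inter> s = {} \<and> c \<inter> s = {}}" "card {b, d} = 2"
    using assms by auto
  then have "2 \<le> card {s \<in> PV. a \<inter> s = {} \<and> c \<inter> s = {}}"
    using finite_PV card_mono[of "{s \<in> PV. a \<inter> s = {} \<and> c \<inter> s = {}}" "{b, d}"] by simp
  then show False
    using ne unfolding card_common_neighbours[OF assms(1,3)] card_Int_PV[OF assms(1,3)]
    by (auto split: if_splits simp: choose_two)
qed

text \<open>Pigeonhole: the graph is 3-regular, by the count of common neighbours of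
  \<open>s\<close> with itself.\<close>

lemma neighbours_not_distinct:
  assumes "s \<in> PV" "{a, b, c, d} \<subseteq> {v \<in> PV. s \<inter> v = {}}"
  shows "a = b \<or> a = c \<or> a = d \<or> b = c \<or> b = d \<or> c = d"
proof (rule ccontr)
  assume "\<not> ?thesis"
  then have "card {a, b, c, d} = 4" by simp
  moreover have "card {v \<in> PV. s \<inter> v = {}} = 3"
    using card_common_neighbours[OF assms(1,1)] PV_D[OF assms(1)] by (simp add: choose_two)
  moreover have "card {a, b, c, d} \<le> card {v \<in> PV. s \<inter> v = {}}"
    using assms(2) finite_PV by (intro card_mono) auto
  ultimately show False by simp
qed

text \<open>The number of common neighbours of the four legs; as a diagram, a four-valent equality
  vertex with an adjacency tensor on each leg.\<close>

definition star :: "nat set \<Rightarrow> nat set \<Rightarrow> nat set \<Rightarrow> nat set \<Rightarrow> complex" where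
  "star a b c d = (\<Sum>s\<in>PV. adj s a * adj s b * adj s c * adj s d)"

definition all_same :: "nat set \<Rightarrow> nat set \<Rightarrow> nat set \<Rightarrow> nat set \<Rightarrow> complex" where
  "all_same a b c d = of_bool (a = b \<and> b = c \<and> c = d)"

definition adj_cross :: "nat set \<Rightarrow> nat set \<Rightarrow> nat set \<Rightarrow> nat set \<Rightarrow> complex" where
  "adj_cross a b c d = same a c * same b d * adj a b"

section \<open>Planar four-leg tensors and the crossing\<close>

lemma Q4_add: "Q4 h \<Longrightarrow> Q4 h' \<Longrightarrow> Q4 (\<lambda>a b c d. h a b c d + h' a b c d)"
  by (rule Q_add)

lemma Q4_smult: "Q4 h \<Longrightarrow> Q4 (\<lambda>a b c d. z * h a b c d)"
  by (rule Q_smult)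

lemma Q4_diff:
  assumes "Q4 h" "Q4 h'"
  shows "Q4 (\<lambda>a b c d. h a b c d - h' a b c d)"
  using Q4_add[OF assms(1) Q4_smult[OF assms(2), of "- 1"]] by simp

lemma Q4_cong:
  assumes "Q4 h"
    and "\<And>a b c d. \<lbrakk>a \<in> PV; b \<in> PV; c \<in> PV; d \<in> PV\<rbrakk> \<Longrightarrow> h a b c d = h' a b c d"
  shows "Q4 h'"
  by (rule Q4I[OF assms(1)]) (simp add: assms(2))

lemma Q4_one: "Q4 (\<lambda>_ _ _ _. 1)"
  by (rule Q_one)

lemma Q4_all_same: "Q4 all_same"
  by (rule Q4_cong[OF Q4_mult23[OF Q4_mult12[OF Q4_mult01[OF Q4_one invariant_kernel_same] invariant_kernel_same] invariant_kernel_same]])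
    (simp add: same_def all_same_def)

text \<open>Adjacency is applied to the four legs of \<open>all_same\<close> in turn. The first
  three sums collapse through the remaining equalities; the fourth variable survives as the
  centre.\<close>

lemma Q4_star: "Q4 star"
proof -
  have "Q4 (\<lambda>a b c d. of_bool (b = c \<and> c = d) * adj b a)"
  proof (rule Q4_cong[OF Q4_act0[OF Q4_all_same invariant_kernel_adj]])
    fix a b c d assume "b \<in> PV"
    then have "(\<Sum>x\<in>PV. all_same x b c d * adj x a) = all_same b b c d * adj b a"
      by (intro sum_PV_single) (auto simp: all_same_def)
    then show "(\<Sum>x\<in>PV. all_same x b c d * adj x a) = of_bool (b = c \<and> c = d) * adj b a"
      by (simp add: all_same_def)
  qed
  note 1 = Q4_act1[OF this invariant_kernel_adj]
  have "Q4 (\<lambda>a b c d. of_bool (c = d) * (adj c a * adj c b))"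
  proof (rule Q4_cong[OF 1])
    fix a b c d assume "c \<in> PV"
    then have "(\<Sum>x\<in>PV. of_bool (x = c \<and> c = d) * adj x a * adj x b)
        = of_bool (c = c \<and> c = d) * adj c a * adj c b"
      by (intro sum_PV_single) auto
    then show "(\<Sum>x\<in>PV. of_bool (x = c \<and> c = d) * adj x a * adj x b) = of_bool (c = d) * (adj c a * adj c b)"
      by simp
  qed
  note 2 = Q4_act2[OF this invariant_kernel_adj]
  have "Q4 (\<lambda>a b c d. adj d a * adj d b * adj d c)"
  proof (rule Q4_cong[OF 2])
    fix a b c d assume "d \<in> PV"
    then have "(\<Sum>x\<in>PV. of_bool (x = d) * (adj x a * adj x b) * adj x c)
        = of_bool (d = d) * (adj d a * adj d b) * adj d c"
      by (intro sum_PV_single) auto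
    then show "(\<Sum>x\<in>PV. of_bool (x = d) * (adj x a * adj x b) * adj x c) = adj d a * adj d b * adj d c"
      by simp
  qed
  from Q4_act3[OF this invariant_kernel_adj] show ?thesis unfolding star_def .
qed

text \<open>A line joins legs 0 and 2; legs 1 and 3 are all-ones vectors, one under the line and one
  outside, so nothing crosses.\<close>

lemma Q4_same02: "Q4 (\<lambda>a b c d. same a c)"
proof -
  have "Q (2 + 1 + 1) (\<lambda>xs. same (xs ! 0) (xs ! 2))"
    by (rule Q_cong[OF Q_tprod[OF Q_insert[OF Q_rel[OF invariant_kernel_same] Q_one[of 1], of 1] Q_one[of 1]]])
      (auto simp: numeral_eq_Suc length_Suc_conv)
  then show ?thesis by (rule Q_idx) simp
qed

text \<open>A closed walk of length four in the Petersen graph degenerates, so \<open>a\<close> and \<open>c\<close> or \<open>b\<close> and \<open>d\<close>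
  coincide: inclusion-exclusion gives the crossing on adjacent vertices as
  planar + planar - (4-cycle).\<close>

lemma Q4_adj_cross: "Q4 adj_cross"
proof -
  let ?U = "\<lambda>a b c d. same a c * adj a b * adj d a"
  have U: "Q4 ?U" by (intro Q4_mult30 Q4_mult01 Q4_same02 invariant_kernel_adj)
  have "Q4 (\<lambda>a b c d. 1 * adj a b * adj b c * adj c d * adj d a)"
    by (intro Q4_mult30 Q4_mult23 Q4_mult12 Q4_mult01 Q4_one invariant_kernel_adj)
  from Q4_diff[OF Q4_add[OF U Q4_rotate[OF U]] this] show ?thesis
  proof (rule Q4_cong)
    fix a b c d assume "a \<in> PV" "b \<in> PV" "c \<in> PV" "d \<in> PV"
    note n = no_four_cycle[OF this]
    show "same a c * adj a b * adj d a + same b d * adj b c * adj a b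
        - 1 * adj a b * adj b c * adj c d * adj d a = adj_cross a b c d"
      unfolding same_def adj_def adj_cross_def using n by (auto simp: Int_commute)
  qed
qed

text \<open>The identification of the opposite legs \<open>a\<close> and \<open>c\<close> separates \<open>b\<close> from \<open>d\<close>; the centre of the star,
  being adjacent to \<open>a\<close>, is carried across by \<open>adj_cross\<close>.\<close>

lemma Q4_star_same02: "Q4 (\<lambda>a b c d. star a b c d * same a c)"
proof -
  have "Q4 (\<lambda>a b c d. same a c * adj a d * adj d b)"
  proof (rule Q4_cong[OF Q4_act1[OF Q4_adj_cross invariant_kernel_adj]])
    fix a b c d assume "d \<in> PV"
    then have "(\<Sum>x\<in>PV. adj_cross a x c d * adj x b) = adj_cross a d c d * adj d b"
      by (intro sum_PV_single) (auto simp: adj_cross_def same_def)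
    then show "(\<Sum>x\<in>PV. adj_cross a x c d * adj x b) = same a c * adj a d * adj d b"
      by (simp add: adj_cross_def same_def)
  qed
  from Q4_act3[OF this invariant_kernel_adj] show ?thesis
  proof (rule Q4_cong)
    fix a b c d :: "nat set"
    \<comment> \<open>When \<open>a = c\<close>, the 0/1-valued factor \<open>adj a x\<close> equals
      its square and so serves both legs.\<close>
    have "same a c * adj a x * adj x b * adj x d = adj x a * adj x b * adj x c * adj x d * same a c" for x
      unfolding same_def adj_def by (auto simp: Int_commute)
    then show "(\<Sum>x\<in>PV. same a c * adj a x * adj x b * adj x d) = star a b c d * same a c"
      unfolding star_def sum_distrib_right by (intro sum.cong refl)
  qed
qed

lemma Q4_star_same13: "Q4 (\<lambda>a b c d. star a b c d * same b d)"
  by (rule Q4_cong[OF Q4_rotate[OF Q4_star_same02]]) (simp add: star_def mult_ac)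

text \<open>The centre has only three neighbours, so the indicator of four distinct legs vanishes on the
  support of \<open>star\<close>. Its expansion over the set partitions of the legs has the coefficients
  of the Moebius function of the partition lattice; we solve it for the crossing partition.\<close>

lemma star_moebius:
  assumes "a \<in> PV" "b \<in> PV" "c \<in> PV" "d \<in> PV"
  shows "star a b c d * (same a c * same b d) = star a b c d *
    (- 1 + (same a b + same a c + same d a + same b c + same b d + same c d)
     - same a b * same c d - same b c * same d a
     - 2 * (same a b * same b c + same a b * same d a + same c d * same d a + same b c * same c d)
     + 6 * (same a b * same b c * same c d))"
proof (cases "star a b c d = 0")
  case False
  then obtain s where "s \<in> PV" "adj s a * adj s b * adj s c * adj s d \<noteq> 0"
    unfolding star_def using sum.not_neutral_contains_not_neutral by blast
  then have "{a, b, c, d} \<subseteq> {v \<in> PV. s \<inter> v = {}}"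
    using assms unfolding adj_def by auto
  from neighbours_not_distinct[OF \<open>s \<in> PV\<close> this] show ?thesis
    unfolding same_def by auto
qed simp

text \<open>On the support of the crossing, \<open>star\<close> counts the common neighbours of
  \<open>a\<close> and \<open>b\<close>: 1 at distance two, as wanted; 0 for adjacent vertices,
  where \<open>adj_cross\<close> supplies the 1; 3 for equal ones, where \<open>all_same\<close>
  removes 2.\<close>

lemma same_cross_eq:
  assumes "a \<in> PV" "b \<in> PV"
  shows "same a c * same b d =
    adj_cross a b c d + star a b c d * (same a c * same b d) - 2 * all_same a b c d"
proof (cases "a = c \<and> b = d")
  case True
  have "star a b a b = (\<Sum>s\<in>PV. adj s a * adj s b)"
    unfolding star_def adj_def by (intro sum.cong) auto
  then have s: "star a b a b = (if a = b then 3 else if a \<inter> b = {} then 0 else 1)"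
    using sum_adj_adj[OF assms] by simp
  \<comment> \<open>The empty set would be disjoint from itself; excluding it makes
    \<open>adj_cross\<close> vanish for \<open>a = b\<close>.\<close>
  have "a \<noteq> {}" using PV_D[OF assms(1)] by auto
  then show ?thesis
    using True s unfolding same_def adj_def adj_cross_def all_same_def by auto
qed (auto simp: same_def adj_cross_def all_same_def)

text \<open>After \<open>star_moebius\<close>, each term is planar: \<open>star\<close> carries only
  equalities of neighbouring legs, or a single equality of opposite legs.\<close>

lemma Q4_cross: "Q4 (\<lambda>a b c d. same a c * same b d)"
proof -
  note r = invariant_kernel_same
  note S = Q4_star
  note ab = Q4_mult01[OF S r] and bc = Q4_mult12[OF S r] and cd = Q4_mult23[OF S r]
    and da = Q4_mult30[OF S r]
  note sums = Q4_smult[OF S, of "- 1"] ab Q4_star_same02 da bc Q4_star_same13 cd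
    Q4_smult[OF Q4_mult23[OF ab r], of "- 1"] Q4_smult[OF Q4_mult30[OF bc r], of "- 1"]
    Q4_smult[OF Q4_mult12[OF ab r], of "- 2"] Q4_smult[OF Q4_mult30[OF ab r], of "- 2"]
    Q4_smult[OF Q4_mult30[OF cd r], of "- 2"] Q4_smult[OF Q4_mult23[OF bc r], of "- 2"]
    Q4_smult[OF Q4_mult23[OF Q4_mult12[OF ab r] r], of 6]
    Q4_smult[OF Q4_all_same, of "- 2"]
  have "Q4 (\<lambda>a b c d. adj_cross a b c d +
      (- 1 * star a b c d + (star a b c d * same a b + (star a b c d * same a c
      + (star a b c d * same d a + (star a b c d * same b c + (star a b c d * same b d
      + (star a b c d * same c d
      + (- 1 * (star a b c d * same a b * same c d) + (- 1 * (star a b c d * same b c * same d a)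
      + (- 2 * (star a b c d * same a b * same b c) + (- 2 * (star a b c d * same a b * same d a)
      + (- 2 * (star a b c d * same c d * same d a) + (- 2 * (star a b c d * same b c * same c d)
      + (6 * (star a b c d * same a b * same b c * same c d)
      + - 2 * all_same a b c d)))))))))))))))"
    by (intro Q4_add Q4_adj_cross sums)
  then show ?thesis
  proof (rule Q4_cong, goal_cases)
    case (1 a b c d)
    show ?case
      by (subst same_cross_eq[OF 1(1,2)], subst star_moebius[OF 1]) (simp add: algebra_simps)
  qed
qed

text \<open>Grafting pairs the legs in reversed order, so a box identifying its opposite legs
  exchanges the two strands.\<close>

lemma Q_swap_adjacent:
  assumes "Q n f" "Suc k < n"
  shows "Q n (\<lambda>zs. f (take k zs @ zs ! Suc k # zs ! k # drop (k + 2) zs))"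
  using Q_graft4[OF assms(1) Q4_cross assms(2)]
proof (rule Q_cong)
  fix zs :: "nat set list" assume z: "length zs = n" "set zs \<subseteq> PV"
  have m: "zs ! k \<in> PV" "zs ! Suc k \<in> PV" using z assms(2) by (auto simp: subset_iff)
  have "(\<Sum>x\<in>PV. \<Sum>y\<in>PV. f (take k zs @ x # y # drop (k + 2) zs) * (same y (zs ! k) * same x (zs ! Suc k)))
      = (\<Sum>y\<in>PV. f (take k zs @ zs ! Suc k # y # drop (k + 2) zs) * (same y (zs ! k) * same (zs ! Suc k) (zs ! Suc k)))"
    by (rule sum_PV_single) (use m in \<open>auto intro: sum.neutral simp: same_def\<close>)
  also have "\<dots> = f (take k zs @ zs ! Suc k # zs ! k # drop (k + 2) zs) * (same (zs ! k) (zs ! k) * same (zs ! Suc k) (zs ! Suc k))"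
    by (rule sum_PV_single) (use m in \<open>auto simp: same_def\<close>)
  finally show "(\<Sum>x\<in>PV. \<Sum>y\<in>PV. f (take k zs @ x # y # drop (k + 2) zs) * (same y (zs ! k) * same x (zs ! Suc k)))
      = f (take k zs @ zs ! Suc k # zs ! k # drop (k + 2) zs)"
    by (simp add: same_def)
qed

section \<open>Invariant tensors are generated\<close>

text \<open>The factor is moved next to \<open>zs ! i\<close> by adjacent swaps.\<close>

lemma Q_mult_pair:
  assumes "Q n f" "invariant_kernel R" "i < j" "j < n"
  shows "Q n (\<lambda>zs. f zs * R (zs ! i) (zs ! j))"
proof -
  have "Q n (\<lambda>zs. f zs * R (zs ! i) (zs ! (Suc i + d)))" if "Q n f" "Suc i + d < n" for d f
    using that
  proof (induction d arbitrary: f)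
    case 0
    then show ?case using Q_mult_adjacent[OF _ assms(2)] by simp
  next
    case (Suc d)
    let ?k = "Suc i + d"
    let ?s = "\<lambda>zs::nat set list. take ?k zs @ zs ! Suc ?k # zs ! ?k # drop (?k + 2) zs"
    have k: "Suc ?k < n" using Suc.prems by simp
    \<comment> \<open>The hypothesis is applied to \<open>f\<close> with two legs already swapped;
      the swap that follows restores \<open>f\<close> and shifts only the second argument of
      \<open>R\<close>.\<close>
    then have "Q n (\<lambda>zs. f (?s zs) * R (zs ! i) (zs ! ?k))"
      by (intro Suc.IH Q_swap_adjacent Suc.prems(1)) simp_all
    from Q_swap_adjacent[OF this k] show ?case
    proof (rule Q_cong)
      fix zs :: "nat set list" assume z: "length zs = n"
      have l: "length (take ?k zs) = ?k" using z k by simp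
      have "take ?k (?s zs) = take ?k zs" "drop (?k + 2) (?s zs) = drop (?k + 2) zs"
        "?s zs ! ?k = zs ! Suc ?k" "?s zs ! Suc ?k = zs ! ?k"
        using l by (simp_all add: nth_append)
      moreover have "?s zs ! i = zs ! i" using l by (simp add: nth_append)
      moreover have "take ?k zs @ zs ! ?k # zs ! Suc ?k # drop (?k + 2) zs = zs"
        using drop_two[of ?k zs] append_take_drop_id[of ?k zs] k z by simp
      ultimately show "f (?s (?s zs)) * R (?s zs ! i) (?s zs ! ?k) = f zs * R (zs ! i) (zs ! (Suc i + Suc d))"
        by (simp only: add_Suc_right)
    qed
  qed
  from this[OF assms(1), of "j - Suc i"] assms(3,4) show ?thesis by simp
qed

lemma Q_prod_pairs:
  assumes "finite I" "\<And>i j. (i, j) \<in> I \<Longrightarrow> i < j \<and> j < n \<and> invariant_kernel (R i j)"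
  shows "Q n (\<lambda>zs. \<Prod>(i, j)\<in>I. R i j (zs ! i) (zs ! j))"
  using assms
proof (induction I rule: finite_induct)
  case empty
  show ?case by (simp add: Q_one)
next
  case (insert p I)
  obtain i j where p: "p = (i, j)" by (cases p)
  have "Q n (\<lambda>zs. (\<Prod>(i, j)\<in>I. R i j (zs ! i) (zs ! j)) * R i j (zs ! i) (zs ! j))"
    by (rule Q_mult_pair) (use insert p in auto)
  then show ?case using insert.hyps p by (simp add: mult.commute)
qed

section \<open>Summation over auxiliary legs\<close>

lemma Q_sum_last:
  assumes "Q (Suc n) f"
  shows "Q n (\<lambda>xs. \<Sum>v\<in>PV. f (xs @ [v]))"
proof -
  \<comment> \<open>The all-ones vector has no leg besides the joined one, so grafting it caps the
    last leg and sums over it.\<close>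
  have "Q (Suc 0) (\<lambda>_. 1)" by (rule Q_one)
  note g = Q_graft[OF assms this, of n]
  have "Q n (\<lambda>zs. \<Sum>x\<in>PV. f (take n zs @ x # drop (n + 0) zs) * 1)"
    by (rule Q_idx[OF g]) simp_all
  then show ?thesis by (rule Q_cong) simp
qed

definition PV_lists :: "nat \<Rightarrow> nat set list set" where
  "PV_lists n = {xs. length xs = n \<and> set xs \<subseteq> PV}"

lemma finite_PV_lists: "finite (PV_lists n)"
  using finite_lists_length_eq[OF finite_PV] unfolding PV_lists_def by (simp add: conj_commute)

text \<open>This eliminates the vertices of a frame, which enter as four auxiliary legs after the
  \<open>n\<close> actual ones.\<close>

lemma Q_sum_tail:
  assumes "Q (n + m) f"
  shows "Q n (\<lambda>xs. \<Sum>zs\<in>PV_lists m. f (xs @ zs))"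
  using assms
proof (induction m arbitrary: f)
  case 0
  have "PV_lists 0 = {[]}" unfolding PV_lists_def by auto
  then show ?case using 0 by simp
next
  case (Suc m)
  have "bij_betw (\<lambda>(zs, v). zs @ [v]) (PV_lists m \<times> PV) (PV_lists (Suc m))"
    by (rule bij_betwI[where g = "\<lambda>xs. (butlast xs, last xs)"])
      (auto simp: PV_lists_def length_Suc_conv_rev)
  from sum.reindex_bij_betw[OF this]
  have "(\<Sum>zs\<in>PV_lists m. \<Sum>v\<in>PV. f (xs @ zs @ [v])) = (\<Sum>zs\<in>PV_lists (Suc m). f (xs @ zs))" for xs
    by (simp add: sum.cartesian_product case_prod_beta)
  moreover have "Q n (\<lambda>xs. \<Sum>zs\<in>PV_lists m. \<Sum>v\<in>PV. f (xs @ zs @ [v]))"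
    using Suc.IH[OF Q_sum_last, of f] Suc.prems by simp
  ultimately show ?case by simp
qed

text \<open>Four vertices on whose orbit \<open>S\<^sub>5\<close> acts simply transitively, the orbit being cut out by the
  pairwise relations of the vertices.\<close>

definition frame :: "nat set list" where
  "frame = [{1, 2}, {2, 3}, {3, 4}, {4, 5}]"

lemma PV_explicit:
  "PV = {{1, 2}, {1, 3}, {1, 4}, {1, 5}, {2, 3}, {2, 4}, {2, 5}, {3, 4}, {3, 5}, {4, 5}}" (is "_ = ?S")
proof
  show "?S \<subseteq> PV" unfolding PV_def by auto
  show "PV \<subseteq> ?S"
  proof
    fix A assume "A \<in> PV"
    then obtain x y where A: "A = {x, y}" "x \<noteq> y" "x \<in> {1..5}" "y \<in> {1..5}"
      unfolding PV_def by (auto simp: card_2_iff)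
    have "x = 1 \<or> x = 2 \<or> x = 3 \<or> x = 4 \<or> x = 5" "y = 1 \<or> y = 2 \<or> y = 3 \<or> y = 4 \<or> y = 5"
      using A by auto
    then show "A \<in> ?S" unfolding A(1) using A(2) by (elim disjE) (simp_all add: insert_commute)
  qed
qed

text \<open>The data are the sums of consecutive entries of the indicator vector on
  \<open>{1..5}\<close>. Two vectors with equal data differ by a multiple of (1,-1,1,-1,1), which is
  zero as both have total 2. The proof checks the finitely many pairs.\<close>

lemma frame_separates:
  assumes "v \<in> PV" "w \<in> PV"
    and "\<And>i. i < 4 \<Longrightarrow> card (v \<inter> frame ! i) = card (w \<inter> frame ! i)"
  shows "v = w"
proof -
  have c: "card (v \<inter> {1, 2}) = card (w \<inter> {1, 2})" "card (v \<inter> {2, 3}) = card (w \<inter> {2, 3})"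
    "card (v \<inter> {3, 4}) = card (w \<inter> {3, 4})" "card (v \<inter> {4, 5}) = card (w \<inter> {4, 5})"
    using assms(3)[of 0] assms(3)[of 1] assms(3)[of 2] assms(3)[of 3] unfolding frame_def by simp_all
  show ?thesis
    using assms(1,2) c unfolding PV_explicit insert_iff empty_iff
    by (elim disjE) simp_all
qed

lemma Int_eq_singleton:
  assumes "card (A \<inter> B) = 1"
  obtains x where "A \<inter> B = {x}"
  using assms card_1_singletonE by blast

lemma PV_eq_pair: "A \<in> PV \<Longrightarrow> x \<in> A \<Longrightarrow> y \<in> A \<Longrightarrow> x \<noteq> y \<Longrightarrow> A = {x, y}"
  unfolding PV_def by (auto simp: card_2_iff)

lemma PV_other:
  assumes "A \<in> PV" "x \<in> A"
  obtains y where "A = {x, y}" "x \<noteq> y"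
  using assms unfolding PV_def by (auto simp: card_2_iff)

text \<open>The list is a path of four 2-sets: consecutive ones share a point and the others are
  disjoint. The three shared points and the two free ends, read along the path, are the images of 1
  to 5.\<close>

lemma frame_transitive:
  assumes z: "zs \<in> PV_lists 4"
    and c: "\<And>i j. i < j \<Longrightarrow> j < 4 \<Longrightarrow> card (zs ! i \<inter> zs ! j) = card (frame ! i \<inter> frame ! j)"
  obtains \<sigma> where "\<sigma> permutes {1..5}" "zs = map (\<lambda>A. \<sigma> ` A) frame"
proof -
  obtain p q r s where zs: "zs = [p, q, r, s]" and PV: "p \<in> PV" "q \<in> PV" "r \<in> PV" "s \<in> PV"
    using z unfolding PV_lists_def by (auto simp: numeral_eq_Suc length_Suc_conv)
  have c1: "card (p \<inter> q) = 1" "card (q \<inter> r) = 1" "card (r \<inter> s) = 1"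
    using c[of 0 1] c[of 1 2] c[of 2 3] unfolding zs frame_def by simp_all
  have "card (p \<inter> r) = 0" "card (p \<inter> s) = 0" "card (q \<inter> s) = 0"
    using c[of 0 2] c[of 0 3] c[of 1 3] unfolding zs frame_def by simp_all
  then have dis: "p \<inter> r = {}" "p \<inter> s = {}" "q \<inter> s = {}"
    using PV[THEN PV_D] by (auto simp: card_eq_0_iff)
  obtain b c' d where b: "p \<inter> q = {b}" and c': "q \<inter> r = {c'}" and d: "r \<inter> s = {d}"
    using c1 by (meson Int_eq_singleton)
  have mem: "b \<in> p" "b \<in> q" "c' \<in> q" "c' \<in> r" "d \<in> r" "d \<in> s" using b c' d by auto
  \<comment> \<open>Equality would give a point common to \<open>p\<close> and \<open>r\<close>, or
    to \<open>q\<close> and \<open>s\<close>.\<close>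
  have ne: "b \<noteq> c'" "c' \<noteq> d" using dis mem by auto
  have q: "q = {b, c'}" using PV(2) mem(2,3) ne(1) by (rule PV_eq_pair)
  have r: "r = {c', d}" using PV(3) mem(4,5) ne(2) by (rule PV_eq_pair)
  obtain a where a: "p = {b, a}" "b \<noteq> a" using PV(1) mem(1) by (rule PV_other)
  obtain e where e: "s = {d, e}" "d \<noteq> e" using PV(4) mem(6) by (rule PV_other)
  have dist: "distinct [a, b, c', d, e]"
    using dis a e ne unfolding q r by auto
  have sub: "{a, b, c', d, e} \<subseteq> {1..5}"
    using PV[THEN PV_D] unfolding q r a(1) e(1) by blast
  define \<sigma> where "\<sigma> = id(1 := a, 2 := b, 3 := c', 4 := d, 5 := e)"
  have I: "{1..5::nat} = {1, 2, 3, 4, 5}" by auto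
  have "inj_on \<sigma> {1..5}" using dist unfolding I \<sigma>_def by auto
  moreover have "\<sigma> ` {1..5} \<subseteq> {1..5}" using sub unfolding I \<sigma>_def by simp
  ultimately have "bij_betw \<sigma> {1..5} {1..5}"
    by (simp add: bij_betw_def endo_inj_surj)
  then have "\<sigma> permutes {1..5}"
    by (rule bij_imp_permutes) (auto simp: \<sigma>_def)
  moreover have "zs = map (\<lambda>A. \<sigma> ` A) frame"
    unfolding zs frame_def q r a(1) e(1) by (auto simp: \<sigma>_def)
  ultimately show ?thesis by (rule that)
qed

section \<open>Pairwise patterns and orbit sums\<close>

lemma card_image_Int_permutes:
  assumes "\<pi> permutes S"
  shows "card (\<pi> ` A \<inter> \<pi> ` B) = card (A \<inter> B)"
  using card_image[OF inj_on_subset[OF permutes_inj[OF assms]], of "A \<inter> B"]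
  by (simp add: image_Int[OF permutes_inj[OF assms]])

text \<open>For vertices, the intersection size encodes the relation of a pair: 2 equal, 1 at
  distance two, 0 adjacent. The product form is the one to which \<open>Q_prod_pairs\<close>
  applies.\<close>

definition pattern_ind :: "nat \<Rightarrow> nat set list \<Rightarrow> nat set list \<Rightarrow> complex" where
  "pattern_ind n ys zs = (\<Prod>(i, j)\<in>{(i, j). i < j \<and> j < n}.
     of_bool (card (zs ! i \<inter> zs ! j) = card (ys ! i \<inter> ys ! j)))"

lemma finite_pairs: "finite {(i, j). i < j \<and> j < (n::nat)}"
  by (rule finite_subset[of _ "{..<n} \<times> {..<n}"]) auto

lemma Q_pattern_ind: "Q n (pattern_ind n ys)"
proof -
  have "invariant_kernel (\<lambda>v w. of_bool (card (v \<inter> w) = k))" for k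
  proof -
    show ?thesis unfolding invariant_kernel_def by (simp add: card_image_Int_permutes)
  qed
  then show ?thesis
    unfolding pattern_ind_def[abs_def] by (intro Q_prod_pairs[OF finite_pairs]) auto
qed

lemma pattern_ind_alt:
  "pattern_ind n ys zs = of_bool (\<forall>i j. i < j \<and> j < n \<longrightarrow> card (zs ! i \<inter> zs ! j) = card (ys ! i \<inter> ys ! j))"
proof (cases "\<forall>i j. i < j \<and> j < n \<longrightarrow> card (zs ! i \<inter> zs ! j) = card (ys ! i \<inter> ys ! j)")
  case True
  then show ?thesis unfolding pattern_ind_def by (auto intro: prod.neutral)
next
  case False
  then show ?thesis unfolding pattern_ind_def by (auto simp: prod_zero_iff finite_pairs)
qed

lemma frame_in_PV_lists: "frame \<in> PV_lists 4"
  unfolding PV_lists_def frame_def PV_def by auto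

text \<open>Pulling back by \<open>\<sigma>\<close> turns the second frame into
  \<open>frame\<close>; by \<open>frame_separates\<close>, the intersections with it then fix every
  entry of \<open>ys\<close>.\<close>

lemma pattern_ind_frame:
  assumes xs: "xs \<in> PV_lists n" and ys: "ys \<in> PV_lists n" and \<sigma>: "\<sigma> permutes {1..5}"
  shows "pattern_ind (n + 4) (ys @ frame) (xs @ map (\<lambda>A. \<sigma> ` A) frame)
    = of_bool (ys = map (\<lambda>A. inv \<sigma> ` A) xs)"
proof -
  have l: "length xs = n" "length ys = n" "length frame = 4"
    using xs ys frame_in_PV_lists unfolding PV_lists_def by auto
  have si: "\<sigma> ` inv \<sigma> ` A = A" "inv \<sigma> ` \<sigma> ` A = A" for A
    using permutes_inverses[OF \<sigma>] by (simp_all add: image_image)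
  let ?c = "\<lambda>i j. card ((xs @ map (\<lambda>A. \<sigma> ` A) frame) ! i \<inter> (xs @ map (\<lambda>A. \<sigma> ` A) frame) ! j)
    = card ((ys @ frame) ! i \<inter> (ys @ frame) ! j)"
  have "(\<forall>i j. i < j \<and> j < n + 4 \<longrightarrow> ?c i j) \<longleftrightarrow> ys = map (\<lambda>A. inv \<sigma> ` A) xs"
  proof
    assume "ys = map (\<lambda>A. inv \<sigma> ` A) xs"
    then have "xs = map (\<lambda>A. \<sigma> ` A) ys" by (simp add: o_def si)
    then have e: "xs @ map (\<lambda>A. \<sigma> ` A) frame = map (\<lambda>A. \<sigma> ` A) (ys @ frame)" by simp
    show "\<forall>i j. i < j \<and> j < n + 4 \<longrightarrow> ?c i j"
      unfolding e using l card_image_Int_permutes[OF \<sigma>] by (auto simp del: map_append)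
  next
    assume c: "\<forall>i j. i < j \<and> j < n + 4 \<longrightarrow> ?c i j"
    show "ys = map (\<lambda>A. inv \<sigma> ` A) xs"
    proof (rule nth_equalityI)
      fix k assume k: "k < length ys"
      have "ys ! k = inv \<sigma> ` (xs ! k)"
      proof (rule frame_separates)
        show "ys ! k \<in> PV" using ys k unfolding PV_lists_def by auto
        have "xs ! k \<in> PV" using xs k l unfolding PV_lists_def by auto
        then show "inv \<sigma> ` (xs ! k) \<in> PV"
          using permutes_image_PV_iff[OF permutes_inv[OF \<sigma>]] by blast
        fix i :: nat assume i: "i < 4"
        have "?c k (n + i)" using c k l i by simp
        then have "card (xs ! k \<inter> \<sigma> ` (frame ! i)) = card (ys ! k \<inter> frame ! i)"
          using k l i by (simp add: nth_append)
        then show "card (ys ! k \<inter> frame ! i) = card (inv \<sigma> ` (xs ! k) \<inter> frame ! i)"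
          using card_image_Int_permutes[OF \<sigma>, of "inv \<sigma> ` (xs ! k)" "frame ! i"] by (simp add: si)
      qed
      then show "ys ! k = map (\<lambda>A. inv \<sigma> ` A) xs ! k" using k l by simp
    qed (use l in simp)
  qed
  then show ?thesis unfolding pattern_ind_alt by simp
qed

text \<open>Each of the \<open>card Z\<close> copies \<open>\<sigma> frame\<close> of the frame contributes \<open>T (\<sigma>\<inverse> xs) = T xs\<close> to \<open>F xs\<close>.\<close>

lemma invariant_imp_gen:
  assumes inv: "invariant n T"
  shows "gen Gens n T"
proof -
  define Z where "Z = {zs \<in> PV_lists 4. \<forall>i j. i < j \<and> j < 4 \<longrightarrow>
    card (zs ! i \<inter> zs ! j) = card (frame ! i \<inter> frame ! j)}"
  have Z: "Z \<subseteq> PV_lists 4" unfolding Z_def by auto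
  \<comment> \<open>A nonempty \<open>Z\<close> permits the final division by
    \<open>card Z\<close>.\<close>
  have "frame \<in> Z" unfolding Z_def using frame_in_PV_lists by simp
  then have cZ: "card Z \<noteq> 0"
    using finite_subset[OF Z finite_PV_lists] by auto
  \<comment> \<open>For fixed \<open>ys\<close> the inner sum counts the permutations taking
    \<open>ys\<close> to \<open>xs\<close>, so it is a positive multiple of the orbit sum of
    \<open>ys\<close>.\<close>
  define F where "F = (\<lambda>xs. \<Sum>ys\<in>PV_lists n. T ys *
    (\<Sum>zs\<in>PV_lists 4. pattern_ind (n + 4) (ys @ frame) (xs @ zs)))"
  have "Q n F"
    unfolding F_def by (intro Q_sum finite_PV_lists Q_smult Q_sum_tail Q_pattern_ind)
  have F: "F xs = of_nat (card Z) * T xs" if xs: "xs \<in> PV_lists n" for xs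
  proof -
    have "(\<Sum>ys\<in>PV_lists n. T ys * pattern_ind (n + 4) (ys @ frame) (xs @ zs)) = (if zs \<in> Z then T xs else 0)"
      if zs: "zs \<in> PV_lists 4" for zs
    proof (cases "zs \<in> Z")
      case True
      then obtain \<sigma> where \<sigma>: "\<sigma> permutes {1..5}" "zs = map (\<lambda>A. \<sigma> ` A) frame"
        using frame_transitive[OF zs] unfolding Z_def by blast
      let ?x = "map (\<lambda>A. inv \<sigma> ` A) xs"
      have "?x \<in> PV_lists n"
        using xs permutes_image_PV_iff[OF permutes_inv[OF \<sigma>(1)]] unfolding PV_lists_def by auto
      then have "(\<Sum>ys\<in>PV_lists n. T ys * of_bool (ys = ?x)) = T ?x"
        using finite_PV_lists by (subst sum.remove[of _ ?x]) (auto intro!: sum.neutral)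
      moreover have "T ?x = T xs"
        using inv permutes_inv[OF \<sigma>(1)] unfolding invariant_def by blast
      ultimately show ?thesis
        using True pattern_ind_frame[OF xs _ \<sigma>(1)] unfolding \<sigma>(2) by (simp cong: sum.cong)
    next
      case False
      then obtain i j where ij: "i < j" "j < 4" "card (zs ! i \<inter> zs ! j) \<noteq> card (frame ! i \<inter> frame ! j)"
        using zs unfolding Z_def by blast
      \<comment> \<open>The pattern already fails among the last four entries, which start at index
        \<open>n\<close>.\<close>
      have "pattern_ind (n + 4) (ys @ frame) (xs @ zs) = 0" if "ys \<in> PV_lists n" for ys
      proof -
        have "length xs = n" "length ys = n" using xs that unfolding PV_lists_def by auto
        then have "card ((xs @ zs) ! (n + i) \<inter> (xs @ zs) ! (n + j))
          \<noteq> card ((ys @ frame) ! (n + i) \<inter> (ys @ frame) ! (n + j))"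
          using ij(3) by (simp add: nth_append)
        moreover have "n + i < n + j" "n + j < n + 4" using ij by simp_all
        ultimately show ?thesis unfolding pattern_ind_alt of_bool_eq_0_iff by blast
      qed
      then show ?thesis using False by simp
    qed
    then have "(\<Sum>zs\<in>PV_lists 4. \<Sum>ys\<in>PV_lists n. T ys * pattern_ind (n + 4) (ys @ frame) (xs @ zs))
        = (\<Sum>zs\<in>PV_lists 4. if zs \<in> Z then T xs else 0)"
      by (rule sum.cong[OF refl])
    also have "\<dots> = of_nat (card Z) * T xs"
      using Z finite_PV_lists[of 4] by (simp add: sum.If_cases Int_absorb1)
    finally show ?thesis
      unfolding F_def sum_distrib_left by (subst sum.swap)
  qed
  have "cut n (\<lambda>xs. (1 / of_nat (card Z)) * F xs) = T"
  proof
    fix xs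
    show "cut n (\<lambda>xs. (1 / of_nat (card Z)) * F xs) xs = T xs"
    proof (cases "xs \<in> PV_lists n")
      case True
      then show ?thesis using F[OF True] cZ unfolding cut_def PV_lists_def by simp
    next
      case False
      then have "T xs = 0" using inv is_tensorD unfolding invariant_def PV_lists_def by blast
      then show ?thesis using False unfolding cut_def PV_lists_def by auto
    qed
  qed
  with Q_smult[OF \<open>Q n F\<close>, of "1 / of_nat (card Z)"] show ?thesis unfolding Q_def by simp
qed

theorem theorem5p4:
  shows "\<forall>n T. gen ({(2, T) | T. invariant 2 T} \<union> {(3, GHZ)}) n T \<longleftrightarrow> invariant n T"
  using gen_imp_invariant invariant_imp_gen by blast

end
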